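(* Let $p\in\{-2,2\}$ and $q=2$, let $\tau\in\mathbb{C}$ satisfy $\tau^2-p\tau+q=0$, let $w$ be an even integer with $w\ge 2$, and let $\mathcal{D}$ be the minimal norm representatives digit set modulo $\tau^w$. Then there is an element of $\mathbb{Z}[\tau]$ whose $w$-NAF-expansion (base $\tau$, digit set $\mathcal{D}$) is non-optimal.
   Context: Voronoi cell: $V=\{z\in\mathbb{C}:\ |z|\le|z-y|\text{ for all }y\in\mathbb{Z}[\tau]\}$. Writing $\{x\}$ for the fractional part and $r=\{\mathrm{Re}\,\tau\}$, $t=\mathrm{Im}\,\tau$, its vertices, in cyclic order, are $v_0=\frac12+\frac{i}{2t}(t^2+r^2-r)$, $v_1=r-\frac12+\frac{i}{2t}(t^2-r^2+r)$, $v_2=v_0-1$, $v_3=-v_0$, $v_4=-v_1$, $v_5=-v_2$; if $\mathrm{Re}\,\tau\in\mathbb{Z}$ then $v_1=v_2$ and $v_4=v_5$ and $V$ is a rectangle. Let $m\in\{4,6\}$ be the number of distinct vertices and relabel the distinct vertices in this order as $v_0,\dots,v_{m-1}$ (indices modulo $m$); let $v_{k+1/2}$ be the midpoint of the segment from $v_k$ to $v_{k+1}$. The restricted Voronoi cell $\widetilde V$ consists of the interior of $V$, the open segments from $v_{k+1/2}$ to $v_{k+1}$ (both endpoints excluded) for all $k$, the points $v_{k+1/2}$ for $k\in\{0,\dots,\lfloor m/2\rfloor-1\}$, and the points $v_k$ for $k\in\{1,\dots,\lfloor m/3\rfloor\}$. Minimal norm representatives digit set modulo $\tau^w$: the set $\mathcal{D}\subseteq\mathbb{Z}[\tau]$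 consisting of $0$ and of exactly one representative of each residue class of $\mathbb{Z}[\tau]$ modulo $\tau^w$ that is not divisible by $\tau$, namely the one lying in $\tau^w\widetilde V$. A multi-expansion of $z\in\mathbb{Z}[\tau]$ is a finite multiset of pairs $(d,n)\in(\mathcal{D}\setminus\{0\})\times\mathbb{N}_0$ with $\sum d\,\tau^n=z$; its weight is its cardinality counted with multiplicity. An expansion is a multi-expansion in which the exponents $n$ are pairwise distinct, identified with a finitely supported sequence $(\eta_n)_{n\in\mathbb{N}_0}\in\mathcal{D}^{\mathbb{N}_0}$ with $\sum_n\eta_n\tau^n=z$. A $w$-NAF-expansion is an expansion such that every block of $w$ consecutive digits $\eta_{j+w-1}\ldots\eta_j$ contains at most one non-zero digit. With this digit set, every element of $\mathbb{Z}[\tau]$ has exactly one $w$-NAF-expansion (a known theorem). An expansion of $z$ is optimal if its weight is at most the weight of every multi-expansion of $z$; otherwise it is non-optimal. *)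

theory Defs
  imports "HOL-Analysis.Analysis" "HOL-Computational_Algebra.Polynomial" "HOL-Library.Multiset"
begin

subsection \<open>The ring \<open>\<int>[\<tau>]\<close>\<close>

definition int_adjoin :: "complex \<Rightarrow> complex set" where
  "int_adjoin \<tau> = range (\<lambda>f :: int poly. poly (map_poly of_int f) \<tau>)"

text \<open>
  Divisibility in the ring \<open>\<int>[\<tau>]\<close>; the class operation \<open>dvd\<close> on type \<^typ>\<open>complex\<close> is
  divisibility in a field and hence not the notion needed here.
\<close>

definition adjoin_dvd :: "complex \<Rightarrow> complex \<Rightarrow> complex \<Rightarrow> bool" where
  "adjoin_dvd \<tau> a b \<longleftrightarrow> (\<exists>u\<in>int_adjoin \<tau>. b = a * u)"


subsection \<open>The restricted Voronoi cell\<close>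

definition voronoi_cell :: "complex \<Rightarrow> complex set" where
  "voronoi_cell \<tau> = {z. \<forall>y\<in>int_adjoin \<tau>. cmod z \<le> cmod (z - y)}"

text \<open>
  For an imaginary quadratic integer \<open>\<tau>\<close>, two of the six points can only coincide if they
  are neighbours in the list (namely if \<open>Re \<tau>\<close> is an integer), so \<^const>\<open>remdups\<close> yields the distinct vertices in their cyclic order.
\<close>

definition voronoi_vertices :: "complex \<Rightarrow> complex list" where
  "voronoi_vertices \<tau> =
    (let r = frac (Re \<tau>); t = Im \<tau>;
         v0 = Complex (1 / 2) ((t\<^sup>2 + r\<^sup>2 - r) / (2 * t));
         v1 = Complex (r - 1 / 2) ((t\<^sup>2 - r\<^sup>2 + r) / (2 * t));
         v2 = v0 - 1
     in remdups [v0, v1, v2, - v0, - v1, - v2])"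

definition num_vertices :: "complex \<Rightarrow> nat" where
  "num_vertices \<tau> = length (voronoi_vertices \<tau>)"

definition vertex :: "complex \<Rightarrow> nat \<Rightarrow> complex" where
  "vertex \<tau> k = voronoi_vertices \<tau> ! (k mod num_vertices \<tau>)"

text \<open>The point \<open>v\<^bsub>k+1/2\<^esub>\<close>.\<close>

definition edge_midpoint :: "complex \<Rightarrow> nat \<Rightarrow> complex" where
  "edge_midpoint \<tau> k = midpoint (vertex \<tau> k) (vertex \<tau> (k + 1))"

definition restricted_voronoi_cell :: "complex \<Rightarrow> complex set" where
  "restricted_voronoi_cell \<tau> =
     interior (voronoi_cell \<tau>)
     \<union> (\<Union>k\<in>{..<num_vertices \<tau>}. open_segment (edge_midpoint \<tau> k) (vertex \<tau> (k + 1)))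
     \<union> edge_midpoint \<tau> ` {..<num_vertices \<tau> div 2}
     \<union> vertex \<tau> ` {1..num_vertices \<tau> div 3}"


subsection \<open>Digit sets and expansions\<close>

definition minimal_norm_digit_set :: "complex \<Rightarrow> nat \<Rightarrow> complex set \<Rightarrow> bool" where
  "minimal_norm_digit_set \<tau> w D \<longleftrightarrow>
     D \<subseteq> int_adjoin \<tau> \<and> 0 \<in> D \<and>
     (\<forall>d\<in>D - {0}. \<not> adjoin_dvd \<tau> \<tau> d \<and> d \<in> (\<lambda>x. \<tau> ^ w * x) ` restricted_voronoi_cell \<tau>) \<and>
     (\<forall>z\<in>int_adjoin \<tau>. \<not> adjoin_dvd \<tau> \<tau> z \<longrightarrow> (\<exists>!d. d \<in> D \<and> adjoin_dvd \<tau> (\<tau> ^ w) (d - z)))"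

definition multi_expansion ::
  "complex \<Rightarrow> complex set \<Rightarrow> (complex \<times> nat) multiset \<Rightarrow> complex \<Rightarrow> bool" where
  "multi_expansion \<tau> D M z \<longleftrightarrow>
     set_mset M \<subseteq> (D - {0}) \<times> UNIV \<and> (\<Sum>(d, n)\<in>#M. d * \<tau> ^ n) = z"

definition expansion :: "complex \<Rightarrow> complex set \<Rightarrow> (nat \<Rightarrow> complex) \<Rightarrow> complex \<Rightarrow> bool" where
  "expansion \<tau> D \<eta> z \<longleftrightarrow>
     (\<forall>n. \<eta> n \<in> D) \<and> finite {n. \<eta> n \<noteq> 0} \<and> (\<Sum>n | \<eta> n \<noteq> 0. \<eta> n * \<tau> ^ n) = z"

definition weight :: "(nat \<Rightarrow> complex) \<Rightarrow> nat" where
  "weight \<eta> = card {n. \<eta> n \<noteq> 0}"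

definition w_naf_expansion ::
  "complex \<Rightarrow> nat \<Rightarrow> complex set \<Rightarrow> (nat \<Rightarrow> complex) \<Rightarrow> complex \<Rightarrow> bool" where
  "w_naf_expansion \<tau> w D \<eta> z \<longleftrightarrow>
     expansion \<tau> D \<eta> z \<and> (\<forall>j. card {n \<in> {j..<j + w}. \<eta> n \<noteq> 0} \<le> 1)"

definition optimal_expansion ::
  "complex \<Rightarrow> complex set \<Rightarrow> (nat \<Rightarrow> complex) \<Rightarrow> complex \<Rightarrow> bool" where
  "optimal_expansion \<tau> D \<eta> z \<longleftrightarrow>
     expansion \<tau> D \<eta> z \<and> (\<forall>M. multi_expansion \<tau> D M z \<longrightarrow> weight \<eta> \<le> size M)"

text \<open>
  An expansion, given as a digit sequence, is identified with the following multi-expansion,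
  whose exponents are pairwise distinct.
\<close>

lemma expansion_imp_multi_expansion:
  assumes "expansion \<tau> D \<eta> z"
  defines "M \<equiv> image_mset (\<lambda>n. (\<eta> n, n)) (mset_set {n. \<eta> n \<noteq> 0})"
  shows "multi_expansion \<tau> D M z" "size M = weight \<eta>"
  using assms
  by (auto simp: multi_expansion_def expansion_def weight_def sum_unfold_sum_mset
      image_mset.compositionality o_def)


subsection \<open>Existence and uniqueness of the digit set for norm 2 and trace \<open>\<plusminus>2\<close>\<close>

lemma int_adjoin_quadratic:
  fixes p q :: int
  assumes "\<tau>\<^sup>2 - of_int p * \<tau> + of_int q = 0"
  shows "int_adjoin \<tau> = {of_int a + of_int b * \<tau> | a b. True}" (is "_ = ?R")
proof (intro equalityI subsetI)
  fix x assume "x \<in> int_adjoin \<tau>"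
  then obtain f :: "int poly" where x: "x = poly (map_poly of_int f) \<tau>"
    by (auto simp: int_adjoin_def)
  have "poly (map_poly of_int f) \<tau> \<in> ?R"
  proof (induction f)
    case 0
    show ?case by (auto intro!: exI[of _ 0])
  next
    case (pCons c f)
    then obtain a b where ab: "poly (map_poly of_int f) \<tau> = of_int a + of_int b * \<tau>"
      by blast
    have "\<tau> * \<tau> = of_int p * \<tau> - of_int q"
      using assms by (simp add: power2_eq_square algebra_simps)
    hence "poly (map_poly of_int (pCons c f)) \<tau> = of_int (c - b * q) + of_int (a + b * p) * \<tau>"
      using ab by (simp add: map_poly_pCons distrib_left mult.left_commute[of \<tau>])
        (simp add: algebra_simps)
    thus ?case by blast
  qed
  thus "x \<in> ?R" using x by simp
next
  fix x assume "x \<in> ?R"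
  then obtain a b where "x = of_int a + of_int b * \<tau>" by blast
  hence "x = poly (map_poly of_int [:a, b:]) \<tau>"
    by (simp add: map_poly_pCons)
  thus "x \<in> int_adjoin \<tau>" unfolding int_adjoin_def by blast
qed

lemma quadratic_roots:
  fixes p :: int
  assumes "p \<in> {-2, 2}" "\<tau>\<^sup>2 - of_int p * \<tau> + 2 = 0"
  shows "Re \<tau> = p / 2" "\<bar>Im \<tau>\<bar> = 1"
proof -
  have 1: "(Re \<tau>)\<^sup>2 - (Im \<tau>)\<^sup>2 - p * Re \<tau> + 2 = 0" and 2: "2 * Re \<tau> * Im \<tau> - p * Im \<tau> = 0"
    using arg_cong[OF assms(2), of Re] arg_cong[OF assms(2), of Im]
    by (simp_all add: power2_eq_square)
  have "Im \<tau> \<noteq> 0"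
  proof
    assume "Im \<tau> = 0"
    hence "(Re \<tau> - p / 2)\<^sup>2 + 1 = 0"
      using 1 assms(1) by (auto simp: power2_eq_square algebra_simps)
    thus False using zero_le_power2[of "Re \<tau> - p / 2"] by linarith
  qed
  thus re: "Re \<tau> = p / 2" using 2 by auto
  have "(Im \<tau>)\<^sup>2 = 1" using 1 assms(1) unfolding re by (auto simp: power2_eq_square)
  thus "\<bar>Im \<tau>\<bar> = 1" by (auto simp: power2_eq_1_iff)
qed

lemma int_adjoin_eq_Gauss:
  fixes p :: int
  assumes "p \<in> {-2, 2}" "\<tau>\<^sup>2 - of_int p * \<tau> + 2 = 0"
  shows "int_adjoin \<tau> = {z. Re z \<in> \<int> \<and> Im z \<in> \<int>}"
proof -
  define a0 :: int where "a0 = p div 2"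
  define t :: int where "t = (if Im \<tau> = 1 then 1 else - 1)"
  have \<tau>: "Re \<tau> = of_int a0" "Im \<tau> = of_int t" and t: "t * t = 1"
    using quadratic_roots[OF assms] assms(1) by (auto simp: a0_def t_def abs_if split: if_splits)
  have *: "int_adjoin \<tau> = {of_int a + of_int b * \<tau> | a b. True}"
    using int_adjoin_quadratic[of \<tau> p 2] assms(2) by simp
  show ?thesis
  proof (intro equalityI subsetI)
    fix z assume "z \<in> int_adjoin \<tau>"
    thus "z \<in> {z. Re z \<in> \<int> \<and> Im z \<in> \<int>}" using \<tau> by (auto simp: *)
  next
    fix z assume "z \<in> {z. Re z \<in> \<int> \<and> Im z \<in> \<int>}"
    then obtain x y :: int where "Re z = x" "Im z = y" by (auto elim!: Ints_cases)
    hence "z = of_int (x - t * y * a0) + of_int (t * y) * \<tau>"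
      using \<tau> t by (auto simp: complex_eq_iff simp flip: of_int_mult)
    thus "z \<in> int_adjoin \<tau>" unfolding * by blast
  qed
qed


lemma voronoi_cell_Gauss:
  assumes "int_adjoin \<tau> = {z. Re z \<in> \<int> \<and> Im z \<in> \<int>}"
  shows "voronoi_cell \<tau> = cbox (Complex (- 1 / 2) (- 1 / 2)) (Complex (1 / 2) (1 / 2))"
proof (intro equalityI subsetI)
  fix z assume z: "z \<in> voronoi_cell \<tau>"
  have *: "(Re z)\<^sup>2 + (Im z)\<^sup>2 \<le> (Re z - of_int a)\<^sup>2 + (Im z - of_int b)\<^sup>2" for a b :: int
  proof -
    have "Complex a b \<in> int_adjoin \<tau>" by (simp add: assms)
    hence "cmod z \<le> cmod (z - Complex a b)" using z by (auto simp: voronoi_cell_def)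
    thus ?thesis by (simp add: cmod_def)
  qed
  show "z \<in> cbox (Complex (- 1 / 2) (- 1 / 2)) (Complex (1 / 2) (1 / 2))"
    using *[of 1 0] *[of "-1" 0] *[of 0 1] *[of 0 "-1"]
    by (auto simp: in_cbox_complex_iff power2_eq_square algebra_simps)
next
  fix z assume "z \<in> cbox (Complex (- 1 / 2) (- 1 / 2)) (Complex (1 / 2) (1 / 2))"
  hence z: "\<bar>Re z\<bar> \<le> 1 / 2" "\<bar>Im z\<bar> \<le> 1 / 2" by (auto simp: in_cbox_complex_iff)
  have *: "x\<^sup>2 \<le> (x - of_int a)\<^sup>2" if "\<bar>x\<bar> \<le> 1 / 2" for x :: real and a :: int
  proof -
    have "\<bar>x\<bar> \<le> \<bar>x - of_int a\<bar>"
    proof (cases "a = 0")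
      case False
      hence "\<bar>real_of_int a\<bar> \<ge> 1" by linarith
      thus ?thesis using that by linarith
    qed simp
    thus ?thesis by (rule abs_le_square_iff[THEN iffD1])
  qed
  show "z \<in> voronoi_cell \<tau>"
    unfolding voronoi_cell_def assms
  proof (intro CollectI ballI)
    fix y assume "y \<in> {z. Re z \<in> \<int> \<and> Im z \<in> \<int>}"
    then obtain a b :: int where "Re y = a" "Im y = b" by (auto elim!: Ints_cases)
    thus "cmod z \<le> cmod (z - y)"
      using *[OF z(1), of a] *[OF z(2), of b] by (simp add: cmod_def add_mono)
  qed
qed

text \<open>The restricted Voronoi cell of \<open>\<int>[\<i>]\<close>, in real coordinates.\<close>

definition half_open_square :: "real \<Rightarrow> real \<Rightarrow> bool" where
  "half_open_square x y \<longleftrightarrow>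
    (\<bar>x\<bar> < 1 / 2 \<and> \<bar>y\<bar> < 1 / 2) \<or>
    (y = 1 / 2 \<and> - 1 / 2 < x \<and> x < 0) \<or>
    (x = - 1 / 2 \<and> - 1 / 2 < y \<and> y < 0) \<or>
    (y = - 1 / 2 \<and> 0 < x \<and> x < 1 / 2) \<or>
    (x = 1 / 2 \<and> 0 < y \<and> y < 1 / 2) \<or>
    (x = 0 \<and> y = 1 / 2) \<or> (x = - 1 / 2 \<and> y = 0) \<or> (x = - 1 / 2 \<and> y = 1 / 2)"

lemma half_open_square_bounds: "half_open_square x y \<Longrightarrow> \<bar>x\<bar> \<le> 1 / 2 \<and> \<bar>y\<bar> \<le> 1 / 2"
  unfolding half_open_square_def by auto

lemma half_open_square_exists: "\<exists>(a::int) (b::int). half_open_square (x - a) (y - b)"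
proof -
  define x' y' where "x' = frac x" and "y' = frac y"
  have xy: "0 \<le> x'" "x' < 1" "0 \<le> y'" "y' < 1" by (simp_all add: x'_def y'_def frac_lt_1)
  define a b :: int where
    "a = (if x' > 1 / 2 \<or> x' = 1 / 2 \<and> (y' = 0 \<or> y' \<ge> 1 / 2) then 1 else 0)" and
    "b = (if y' > 1 / 2 \<or> y' = 1 / 2 \<and> 0 < x' \<and> x' < 1 / 2 then 1 else 0)"
  have "half_open_square (x' - a) (y' - b)"
    using xy unfolding half_open_square_def a_def b_def by auto
  moreover have "x' - a = x - of_int (\<lfloor>x\<rfloor> + a)" "y' - b = y - of_int (\<lfloor>y\<rfloor> + b)"
    by (simp_all add: x'_def y'_def frac_def)
  ultimately show ?thesis by metis
qed

lemma half_open_square_edges: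
  "half_open_square (1 / 2) y \<Longrightarrow> 0 < y \<and> y < 1 / 2"
  "half_open_square (- 1 / 2) y \<Longrightarrow> - 1 / 2 < y \<and> y \<le> 0 \<or> y = 1 / 2"
  "half_open_square x (1 / 2) \<Longrightarrow> - 1 / 2 \<le> x \<and> x \<le> 0"
  "half_open_square x (- 1 / 2) \<Longrightarrow> 0 < x \<and> x < 1 / 2"
  unfolding half_open_square_def by auto

lemma half_open_square_unique:
  fixes a b :: int
  assumes "half_open_square x y" "half_open_square (x + a) (y + b)"
  shows "a = 0 \<and> b = 0"
proof -
  note bounds = assms[THEN half_open_square_bounds]
  hence "\<bar>real_of_int a\<bar> \<le> 1" "\<bar>real_of_int b\<bar> \<le> 1" by linarith+
  hence ab: "a = -1 \<or> a = 0 \<or> a = 1" "b = -1 \<or> b = 0 \<or> b = 1" by linarith+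
  have a: "a = 0"
  proof (rule ccontr)
    assume "a \<noteq> 0"
    with ab consider "a = 1" "x = - 1 / 2" | "a = - 1" "x = 1 / 2"
      using bounds by fastforce
    thus False
    proof cases
      case 1
      hence "- 1 / 2 < y \<and> y \<le> 0 \<or> y = 1 / 2" "0 < y + b \<and> y + b < 1 / 2"
        using half_open_square_edges(1,2) assms by force+
      thus False using ab(2) by auto
    next
      case 2
      hence "- 1 / 2 < y + b \<and> y + b \<le> 0 \<or> y + b = 1 / 2" "0 < y \<and> y < 1 / 2"
        using half_open_square_edges(1,2) assms by force+
      thus False using ab(2) by auto
    qed
  qed
  have "b = 0"
  proof (rule ccontr)
    assume "b \<noteq> 0"
    with ab consider "b = 1" "y = - 1 / 2" | "b = - 1" "y = 1 / 2"
      using bounds by fastforce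
    thus False
    proof cases
      case 1
      thus False using half_open_square_edges(3,4)[of x] assms a by force
    next
      case 2
      thus False using half_open_square_edges(3,4)[of x] assms a by force
    qed
  qed
  with a show ?thesis by simp
qed

lemma open_segment_horizontal:
  assumes "Im a = Im b" "Re a \<noteq> Re b"
  shows "z \<in> open_segment a b \<longleftrightarrow>
    Im z = Im a \<and> min (Re a) (Re b) < Re z \<and> Re z < max (Re a) (Re b)"
proof -
  have "z \<in> closed_segment a b \<longleftrightarrow> Im z = Im a \<and> Re z \<in> closed_segment (Re a) (Re b)"
    using closed_segment_same_Im[OF assms(1)] by auto
  thus ?thesis using assms
    by (auto simp: open_segment_def closed_segment_eq_real_ivl complex_eq_iff min_def max_def)
qed

lemma open_segment_vertical:
  assumes "Re a = Re b" "Im a \<noteq> Im b"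
  shows "z \<in> open_segment a b \<longleftrightarrow>
    Re z = Re a \<and> min (Im a) (Im b) < Im z \<and> Im z < max (Im a) (Im b)"
proof -
  have "z \<in> closed_segment a b \<longleftrightarrow> Re z = Re a \<and> Im z \<in> closed_segment (Im a) (Im b)"
    using closed_segment_same_Re[OF assms(1)] by auto
  thus ?thesis using assms
    by (auto simp: open_segment_def closed_segment_eq_real_ivl complex_eq_iff min_def max_def)
qed

lemma voronoi_vertices_Gauss:
  assumes "Re \<tau> \<in> \<int>" "\<bar>Im \<tau>\<bar> = 1"
  defines "t \<equiv> Im \<tau>"
  shows "voronoi_vertices \<tau> = [Complex (1 / 2) (t / 2), Complex (- 1 / 2) (t / 2),
           Complex (- 1 / 2) (- t / 2), Complex (1 / 2) (- t / 2)]"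
proof -
  have t: "t = 1 \<or> t = -1" using assms by (auto simp: abs_if split: if_splits)
  have r: "frac (Re \<tau>) = 0" using assms(1) by simp
  show ?thesis using t unfolding voronoi_vertices_def t_def[symmetric] r
    by (auto simp: Let_def complex_eq_iff power2_eq_square)
qed

lemma restricted_voronoi_cell_Gauss:
  assumes "int_adjoin \<tau> = {z. Re z \<in> \<int> \<and> Im z \<in> \<int>}" "Re \<tau> \<in> \<int>" "\<bar>Im \<tau>\<bar> = 1"
  defines "t \<equiv> Im \<tau>"
  shows "z \<in> restricted_voronoi_cell \<tau> \<longleftrightarrow> half_open_square (Re z) (t * Im z)"
proof -
  have t: "t = 1 \<or> t = -1" using assms by (auto simp: abs_if split: if_splits)
  note vs = voronoi_vertices_Gauss[OF assms(2,3), folded t_def]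
  have n: "num_vertices \<tau> = 4" by (simp add: num_vertices_def vs)
  have v: "vertex \<tau> 0 = Complex (1 / 2) (t / 2)" "vertex \<tau> 1 = Complex (- 1 / 2) (t / 2)"
    "vertex \<tau> 2 = Complex (- 1 / 2) (- t / 2)" "vertex \<tau> 3 = Complex (1 / 2) (- t / 2)"
    "vertex \<tau> 4 = Complex (1 / 2) (t / 2)"
    by (simp_all add: vertex_def n vs)
  have e: "edge_midpoint \<tau> 0 = Complex 0 (t / 2)" "edge_midpoint \<tau> 1 = Complex (- 1 / 2) 0"
    "edge_midpoint \<tau> 2 = Complex 0 (- t / 2)" "edge_midpoint \<tau> 3 = Complex (1 / 2) 0"
    using v by (simp_all add: edge_midpoint_def midpoint_def complex_eq_iff flip: One_nat_def)
  have i: "z \<in> interior (voronoi_cell \<tau>) \<longleftrightarrow> \<bar>Re z\<bar> < 1 / 2 \<and> \<bar>Im z\<bar> < 1 / 2"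
    unfolding voronoi_cell_Gauss[OF assms(1)] interior_cbox by (auto simp: in_box_complex_iff)
  have sets: "{..<num_vertices \<tau>} = {0, 1, 2, 3}" "{..<num_vertices \<tau> div 2} = {0, 1}"
    "{1..num_vertices \<tau> div 3} = {1}"
    unfolding n by auto
  have "z \<in> restricted_voronoi_cell \<tau> \<longleftrightarrow> \<bar>Re z\<bar> < 1 / 2 \<and> \<bar>Im z\<bar> < 1 / 2 \<or>
      z \<in> open_segment (Complex 0 (t / 2)) (Complex (- 1 / 2) (t / 2)) \<or>
      z \<in> open_segment (Complex (- 1 / 2) 0) (Complex (- 1 / 2) (- t / 2)) \<or>
      z \<in> open_segment (Complex 0 (- t / 2)) (Complex (1 / 2) (- t / 2)) \<or>
      z \<in> open_segment (Complex (1 / 2) 0) (Complex (1 / 2) (t / 2)) \<or>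
      z \<in> {Complex 0 (t / 2), Complex (- 1 / 2) 0, Complex (- 1 / 2) (t / 2)}"
    unfolding restricted_voronoi_cell_def sets using v e
    by (simp add: i flip: One_nat_def) blast
  also have "\<dots> \<longleftrightarrow> half_open_square (Re z) (t * Im z)"
    using t unfolding half_open_square_def insert_iff empty_iff simp_thms
    by (intro arg_cong2[where f = "(\<or>)"])
      (auto simp: open_segment_horizontal open_segment_vertical complex_eq_iff)
  finally show ?thesis .
qed

lemma restricted_voronoi_cell_tiling:
  assumes "int_adjoin \<tau> = {z. Re z \<in> \<int> \<and> Im z \<in> \<int>}" "Re \<tau> \<in> \<int>" "\<bar>Im \<tau>\<bar> = 1"
  shows "\<exists>!u. u \<in> int_adjoin \<tau> \<and> z - u \<in> restricted_voronoi_cell \<tau>"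
proof -
  define t where "t = Im \<tau>"
  have t: "t = 1 \<or> t = -1" using assms by (auto simp: t_def abs_if split: if_splits)
  note iff = restricted_voronoi_cell_Gauss[OF assms, folded t_def]
  obtain a b :: int where ab: "half_open_square (Re z - a) (t * Im z - b)"
    using half_open_square_exists by blast
  define u where "u = Complex a (t * b)"
  have "u \<in> int_adjoin \<tau>" using t by (auto simp: u_def assms(1))
  moreover have "z - u \<in> restricted_voronoi_cell \<tau>"
    using t ab by (auto simp: u_def iff algebra_simps)
  ultimately have ex: "\<exists>u. u \<in> int_adjoin \<tau> \<and> z - u \<in> restricted_voronoi_cell \<tau>"
    by blast
  have uniq: "u = v" if "u \<in> int_adjoin \<tau>" "z - u \<in> restricted_voronoi_cell \<tau>"
    "v \<in> int_adjoin \<tau>" "z - v \<in> restricted_voronoi_cell \<tau>" for u v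
  proof -
    have "Re u - Re v \<in> \<int>" "t * (Im u - Im v) \<in> \<int>"
      using that(1,3) t by (auto simp: assms(1))
    then obtain a b :: int where ab: "Re u - Re v = a" "t * (Im u - Im v) = b"
      by (auto elim!: Ints_cases)
    have "Re (z - v) = Re (z - u) + a" "t * Im (z - v) = t * Im (z - u) + b"
      using ab by (auto simp: algebra_simps)
    hence "a = 0 \<and> b = 0"
      using half_open_square_unique that(2,4)[unfolded iff] by metis
    thus ?thesis using ab t by (auto simp: complex_eq_iff)
  qed
  show ?thesis using ex uniq by blast
qed

lemma ex1_minimal_norm_digit_set:
  fixes p :: int
  assumes "p \<in> {-2, 2}" "\<tau>\<^sup>2 - of_int p * \<tau> + 2 = 0" "w \<ge> 1"
  shows "\<exists>!D. minimal_norm_digit_set \<tau> w D"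
proof -
  define Z R where "Z = int_adjoin \<tau>" and "R = restricted_voronoi_cell \<tau>"
  note Gauss = int_adjoin_eq_Gauss[OF assms(1,2)]
  have "Re \<tau> = 1 \<or> Re \<tau> = -1" using quadratic_roots(1)[OF assms(1,2)] assms(1) by force
  hence re: "Re \<tau> \<in> \<int>" by auto
  have im: "\<bar>Im \<tau>\<bar> = 1" by (rule quadratic_roots(2)[OF assms(1,2)])
  note tiling = restricted_voronoi_cell_tiling[OF Gauss re im, folded Z_def R_def]
  have [simp]: "\<tau> \<noteq> 0" using im by auto
  have "Im \<tau> \<in> \<int>" using im by (auto simp: abs_if split: if_splits)
  hence \<tau>: "\<tau> \<in> Z" using re by (simp add: Z_def Gauss)
  have closed: "x + y \<in> Z" "x - y \<in> Z" "x * y \<in> Z" "- x \<in> Z" if "x \<in> Z" "y \<in> Z" for x y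
    using that by (auto simp: Z_def Gauss)
  have pow: "\<tau> ^ n \<in> Z" for n
    by (induction n) (use \<tau> closed in \<open>auto simp: Z_def Gauss\<close>)
  have dvd: "adjoin_dvd \<tau> a b \<longleftrightarrow> (\<exists>u\<in>Z. b = a * u)" for a b
    by (simp add: adjoin_dvd_def Z_def)
  have dvd_cong: "adjoin_dvd \<tau> \<tau> x \<longleftrightarrow> adjoin_dvd \<tau> \<tau> y"
    if xy: "adjoin_dvd \<tau> (\<tau> ^ w) (x - y)" for x y
  proof -
    obtain u where u: "u \<in> Z" "x - y = \<tau> ^ w * u" using xy unfolding dvd by blast
    define v where "v = \<tau> ^ (w - 1) * u"
    have "\<tau> ^ w = \<tau> * \<tau> ^ (w - 1)" using assms(3) by (cases w) auto
    hence "x - y = \<tau> * v" using u(2) by (simp only: v_def mult.assoc)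
    hence v: "x = y + \<tau> * v" "y = x - \<tau> * v" by (simp_all add: diff_eq_eq add.commute)
    have "v \<in> Z" unfolding v_def using u(1) pow closed(3) by blast
    note v = this v
    show ?thesis
    proof
      assume "adjoin_dvd \<tau> \<tau> x"
      then obtain c where "c \<in> Z" "x = \<tau> * c" unfolding dvd by blast
      hence "c - v \<in> Z" "y = \<tau> * (c - v)"
        using v(1,3) closed(2) by (simp_all only: right_diff_distrib)
      thus "adjoin_dvd \<tau> \<tau> y" unfolding dvd by blast
    next
      assume "adjoin_dvd \<tau> \<tau> y"
      then obtain c where "c \<in> Z" "y = \<tau> * c" unfolding dvd by blast
      hence "c + v \<in> Z" "x = \<tau> * (c + v)"
        using v(1,2) closed(1) by (simp_all only: distrib_left)
      thus "adjoin_dvd \<tau> \<tau> x" unfolding dvd by blast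
    qed
  qed
  have "0 \<in> Z" by (simp add: Z_def Gauss)
  hence dvd_0: "adjoin_dvd \<tau> a 0" for a unfolding dvd by force
  define E where "E = {d \<in> Z. \<not> adjoin_dvd \<tau> \<tau> d \<and> d \<in> (\<lambda>x. \<tau> ^ w * x) ` R}"
  have E_ex: "\<exists>d. d \<in> E \<and> adjoin_dvd \<tau> (\<tau> ^ w) (d - z)"
    if z: "z \<in> Z" "\<not> adjoin_dvd \<tau> \<tau> z" for z
  proof -
    obtain u where u: "u \<in> Z" "z / \<tau> ^ w - u \<in> R" using tiling by blast
    define d where "d = \<tau> ^ w * (z / \<tau> ^ w - u)"
    have d: "d = z - \<tau> ^ w * u" by (simp add: d_def algebra_simps)
    have "adjoin_dvd \<tau> (\<tau> ^ w) (d - z)"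
      unfolding dvd d using u closed by (intro bexI[of _ "- u"]) auto
    moreover from this have "\<not> adjoin_dvd \<tau> \<tau> d" using dvd_cong[of d z] z by blast
    moreover have "d \<in> Z" unfolding d using z u pow closed by blast
    moreover have "d \<in> (\<lambda>x. \<tau> ^ w * x) ` R" unfolding d_def using u by blast
    ultimately show ?thesis unfolding E_def by blast
  qed
  have E_uniq: "d = e"
    if de: "d \<in> E" "adjoin_dvd \<tau> (\<tau> ^ w) (d - z)"
      "e \<in> E" "adjoin_dvd \<tau> (\<tau> ^ w) (e - z)" for d e z
  proof -
    obtain u v where u: "u \<in> Z" "d - z = \<tau> ^ w * u" and v: "v \<in> Z" "e - z = \<tau> ^ w * v"
      using de unfolding dvd by blast
    obtain x y where x: "x \<in> R" "d = \<tau> ^ w * x" and y: "y \<in> R" "e = \<tau> ^ w * y"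
      using de unfolding E_def by blast
    have "z = \<tau> ^ w * (x - u)" "z = \<tau> ^ w * (y - v)"
      using u(2) v(2) x(2) y(2) by (simp_all add: algebra_simps)
    hence "z / \<tau> ^ w = x - u" "z / \<tau> ^ w = y - v"
      using \<open>\<tau> \<noteq> 0\<close> by (metis nonzero_mult_div_cancel_left power_not_zero)+
    hence "z / \<tau> ^ w - (- u) = x" "z / \<tau> ^ w - (- v) = y"
      by (metis diff_minus_eq_add diff_add_cancel)+
    moreover have "- u \<in> Z" "- v \<in> Z" using closed(4) u(1) v(1) by blast+
    ultimately have "- u = - v" using tiling[of "z / \<tau> ^ w"] x(1) y(1) by metis
    hence "d - z = e - z" using u(2) v(2) by simp
    thus ?thesis by simp
  qed
  have D: "minimal_norm_digit_set \<tau> w (insert 0 E)"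
    unfolding minimal_norm_digit_set_def Z_def[symmetric] R_def[symmetric]
  proof (intro conjI ballI impI)
    fix z assume z: "z \<in> Z" "\<not> adjoin_dvd \<tau> \<tau> z"
    have "\<not> adjoin_dvd \<tau> (\<tau> ^ w) (0 - z)" using dvd_cong[of 0 z] dvd_0 z by blast
    thus "\<exists>!d. d \<in> insert 0 E \<and> adjoin_dvd \<tau> (\<tau> ^ w) (d - z)"
      using E_ex[OF z] E_uniq[of _ z] by auto
  qed (use \<open>0 \<in> Z\<close> in \<open>auto simp: E_def\<close>)
  moreover have "D' = insert 0 E" if "minimal_norm_digit_set \<tau> w D'" for D'
  proof -
    note D' = that[unfolded minimal_norm_digit_set_def, folded Z_def R_def]
    have sub: "D' - {0} \<subseteq> E" using D' unfolding E_def by blast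
    have "d \<in> D'" if d: "d \<in> E" for d
    proof -
      have dZ: "d \<in> Z" "\<not> adjoin_dvd \<tau> \<tau> d" using d by (auto simp: E_def)
      then obtain e where e: "e \<in> D'" "adjoin_dvd \<tau> (\<tau> ^ w) (e - d)" using D' by blast
      hence "e \<noteq> 0" using dvd_cong[of e d] dvd_0 dZ by blast
      moreover have "adjoin_dvd \<tau> (\<tau> ^ w) (d - d)" using dvd_0 by simp
      ultimately show ?thesis using E_uniq[of d d e] d e sub by blast
    qed
    thus ?thesis using sub D' by blast
  qed
  ultimately show ?thesis by blast
qed

end

theory Submission
  imports Defs
begin

text \<open>
  The roots are \<open>\<plusminus>1 \<plusminus> i\<close>, so \<open>\<int>[\<tau>]\<close> is the ring of Gaussian integers, and for even \<open>w\<close> the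
  power \<open>\<tau>\<^sup>w\<close> is a unit times \<open>2 h\<close> with \<open>h = 2 ^ (w / 2 - 1)\<close>. The digits therefore lie in
  an axis-parallel square of half side \<open>h\<close> whose sides pass through lattice points. Midpoints
  and corners aside, each side contributes only the half that follows its midpoint in the
  orientation given by \<open>\<iota> = i Im \<tau>\<close>. This asymmetry is what makes the NAF lose: an element on a missing half side is no
  digit and has to be replaced by a point of the opposite side together with a carry.

  For \<open>w \<ge> 4\<close>, let \<open>A = h + (h - 1) \<iota>\<close> and \<open>B = h + \<iota>\<close>; both lie on the present half of a side
  and have odd norm, so \<open>u A\<close> and \<open>u B\<close> are digits for all units \<open>u\<close>. Write
  \<open>\<tau> ^ (w - 1) = h \<kappa> (1 - \<iota>)\<close> with a unit \<open>\<kappa>\<close>. Since \<open>\<kappa> - \<kappa> \<iota> A = \<tau> ^ (w - 1)\<close>,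
  \<open>\<kappa> + \<tau> ^ (w - 1) A = \<kappa> \<iota> A + \<tau> ^ (w - 1) (A + 1)\<close>,
  and \<open>A + 1 = (h + 1) + (h - 1) \<iota>\<close> is \<open>\<tau>\<close> times a unit multiple of \<open>h - \<iota>\<close>. That point is on a
  missing half side; it equals \<open>2 h - B\<close>, so it is represented by the digit \<open>- B\<close> and a carry
  \<open>2 h\<close>, which is \<open>\<tau>\<^sup>w\<close> times a unit. The NAF thus has weight \<open>3\<close>, while the left-hand side has
  weight \<open>2\<close>.

  For \<open>w = 2\<close> the points \<open>A\<close> and \<open>B\<close> degenerate to a midpoint and a corner. There the digit set
  is \<open>{0, a, b}\<close> with units \<open>a\<close>, \<open>b\<close>, and the multi-expansion \<open>a + a\<close>
  plays the role of the short representation: \<open>2 a = - \<tau>\<^sup>2 b\<close>, where \<open>- b\<close> is not a digit and needs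
  two carries.
\<close>

section \<open>Beating a NAF of weight three\<close>

text \<open>
  Both constructions end in the same way, up to a shift by \<open>\<tau> ^ k\<close>: an NAF with non-zero digits
  at distance exactly \<open>w\<close>, as close as the width condition permits, against two summands.
\<close>

lemma non_optimal_weight_three:
  fixes \<tau> :: complex
  assumes w: "w \<ge> 1" and zero: "0 \<in> D" and z: "z \<in> int_adjoin \<tau>"
    and digits: "{d\<^sub>0, d\<^sub>1, d\<^sub>2, a, b} \<subseteq> D - {0}"
    and naf: "z = \<tau> ^ k * (d\<^sub>0 + \<tau> ^ w * d\<^sub>1 + \<tau> ^ (2 * w) * d\<^sub>2)"
    and short: "z = a + \<tau> ^ l * b"
  shows "\<exists>z\<in>int_adjoin \<tau>. \<exists>\<eta>. w_naf_expansion \<tau> w D \<eta> z \<and> \<not> optimal_expansion \<tau> D \<eta> z"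
proof -
  define \<eta> where "\<eta> = (\<lambda>n. if n = k then d\<^sub>0 else if n = k + w then d\<^sub>1
                              else if n = k + 2 * w then d\<^sub>2 else 0)"
  have supp: "{n. \<eta> n \<noteq> 0} = {k, k + w, k + 2 * w}"
    using digits by (auto simp: \<eta>_def)
  have vals: "\<eta> k = d\<^sub>0" "\<eta> (k + w) = d\<^sub>1" "\<eta> (k + 2 * w) = d\<^sub>2"
    using w by (auto simp: \<eta>_def)
  have "(\<Sum>n | \<eta> n \<noteq> 0. \<eta> n * \<tau> ^ n) = z"
    unfolding supp naf using w by (simp add: vals) (simp add: power_add algebra_simps)
  moreover have "\<eta> n \<in> D" for n
    using digits zero by (auto simp: \<eta>_def)
  ultimately have exp: "expansion \<tau> D \<eta> z"
    unfolding expansion_def using supp by simp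
  have "card {n \<in> {j..<j + w}. \<eta> n \<noteq> 0} \<le> 1" for j
  proof -
    have "m = n" if "m \<in> {j..<j + w}" "n \<in> {j..<j + w}" "\<eta> m \<noteq> 0" "\<eta> n \<noteq> 0" for m n
      using that by (auto simp: \<eta>_def split: if_splits)
    hence "\<forall>m\<in>{n \<in> {j..<j + w}. \<eta> n \<noteq> 0}. \<forall>n\<in>{n \<in> {j..<j + w}. \<eta> n \<noteq> 0}. m = n"
      by blast
    thus ?thesis by (subst One_nat_def, subst card_le_Suc0_iff_eq) auto
  qed
  with exp have "w_naf_expansion \<tau> w D \<eta> z"
    unfolding w_naf_expansion_def by blast
  moreover have "multi_expansion \<tau> D {#(a, 0), (b, l)#} z"
    unfolding multi_expansion_def short using digits by (auto simp: mult.commute)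
  moreover have "weight \<eta> = 3"
    unfolding weight_def supp using w by simp
  ultimately show ?thesis
    using z unfolding optimal_expansion_def by force
qed

section \<open>The digit set in rotated coordinates\<close>

text \<open>
  In terms of \<open>\<iota>\<close> below, the restricted cell consists of the points \<open>x + y \<iota>\<close> for which
  \<^term>\<open>half_open_square x y\<close> holds, whatever the signs of \<open>Re \<tau>\<close> and \<open>Im \<tau>\<close>. Computing with \<open>\<iota>\<close>
  in place of \<open>i\<close> thus treats conjugate bases simultaneously.
\<close>

locale gaussian_digits =
  fixes \<tau> :: complex and w :: nat and D :: "complex set"
  assumes ring: "int_adjoin \<tau> = {z. Re z \<in> \<int> \<and> Im z \<in> \<int>}"
    and Re_base: "Re \<tau> = 1 \<or> Re \<tau> = - 1"
    and Im_base: "Im \<tau> = 1 \<or> Im \<tau> = - 1"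
    and digit_set: "minimal_norm_digit_set \<tau> w D"
    and w_pos: "w \<ge> 1"
begin

definition \<iota> :: complex where "\<iota> = Complex 0 (Im \<tau>)"

definition units :: "complex set" where "units = {1, -1, \<iota>, - \<iota>}"

lemma iota_square: "\<iota> * \<iota> = - 1" "\<iota> * (\<iota> * x) = - x"
  using Im_base by (auto simp: \<iota>_def complex_eq_iff)

lemma base_eq: "\<tau> = of_real (Re \<tau>) + \<iota>"
  by (simp add: \<iota>_def complex_eq_iff)

lemma units_mult: "u \<in> units \<Longrightarrow> v \<in> units \<Longrightarrow> u * v \<in> units"
  by (auto simp: units_def iota_square)

lemma units_uminus: "u \<in> units \<Longrightarrow> - u \<in> units"
  by (auto simp: units_def)

lemma iota_unit: "\<iota> \<in> units"
  by (simp add: units_def)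

lemma units_inverse: "u \<in> units \<Longrightarrow> \<exists>v\<in>units. u * v = 1"
  by (auto simp: units_def iota_square)

lemma in_ring:
  assumes "u \<in> units" shows "u * (of_int a + of_int b * \<iota>) \<in> int_adjoin \<tau>"
  using assms Im_base by (auto simp: units_def ring \<iota>_def)

lemma norm_coords:
  assumes "u \<in> units"
  shows "(cmod (u * (of_int a + of_int b * \<iota>)))\<^sup>2 = of_int (a\<^sup>2 + b\<^sup>2)"
proof -
  have "cmod u = 1"
    using assms Im_base by (auto simp: units_def \<iota>_def cmod_def)
  thus ?thesis
    using Im_base by (auto simp: norm_mult \<iota>_def cmod_power2 power_mult_distrib)
qed

text \<open>\<open>\<tau>\<close> has norm \<open>2\<close>, so its multiples in the ring have even norm.\<close>

lemma not_dvd_of_odd_norm: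
  assumes "(cmod d)\<^sup>2 = of_int n" "odd n"
  shows "\<not> adjoin_dvd \<tau> \<tau> d"
proof
  assume "adjoin_dvd \<tau> \<tau> d"
  then obtain c where c: "c \<in> int_adjoin \<tau>" "d = \<tau> * c"
    by (auto simp: adjoin_dvd_def)
  then obtain x y :: int where xy: "Re c = x" "Im c = y"
    by (auto simp: ring elim!: Ints_cases)
  have "(cmod \<tau>)\<^sup>2 = 2"
    using Re_base Im_base by (auto simp: cmod_power2)
  hence "(cmod d)\<^sup>2 = of_int (2 * (x\<^sup>2 + y\<^sup>2))"
    using c(2) xy by (simp add: norm_mult power_mult_distrib cmod_power2)
  hence "n = 2 * (x\<^sup>2 + y\<^sup>2)"
    using assms(1) by (metis of_int_eq_iff)
  with assms(2) show False by simp
qed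

text \<open>
  The digit set is given by conditions that its elements satisfy, not by a membership criterion.
  The converse used here follows from the tiling property: the digit \<open>e\<close> in the residue class of
  \<open>d\<close> and \<open>d\<close> itself, divided by \<open>\<tau>\<^sup>w\<close>, are points of the restricted cell that differ by a
  lattice point, hence coincide.
\<close>

lemma digitI:
  assumes d: "d \<in> int_adjoin \<tau>" "\<not> adjoin_dvd \<tau> \<tau> d" "d = \<tau> ^ w * x"
    and x: "half_open_square (Re x) (Im \<tau> * Im x)"
  shows "d \<in> D - {0}"
proof -
  have int: "Re \<tau> \<in> \<int>" "\<bar>Im \<tau>\<bar> = 1" using Re_base Im_base by auto
  have xV: "x \<in> restricted_voronoi_cell \<tau>"
    using x restricted_voronoi_cell_Gauss[OF ring int] by blast
  obtain e where e: "e \<in> D" "adjoin_dvd \<tau> (\<tau> ^ w) (e - d)"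
    using digit_set d(1,2) unfolding minimal_norm_digit_set_def by blast
  then obtain c where c: "c \<in> int_adjoin \<tau>" "e - d = \<tau> ^ w * c"
    by (auto simp: adjoin_dvd_def)
  have [simp]: "\<tau> \<noteq> 0" using Re_base by auto
  have e_eq: "e = \<tau> ^ w * (x + c)"
    using c(2) d(3) by (simp add: algebra_simps)
  have base_in: "\<tau> ^ n * s \<in> int_adjoin \<tau>" if "s \<in> int_adjoin \<tau>" for n s
  proof (induction n)
    case (Suc n)
    have "\<tau> * y \<in> int_adjoin \<tau>" if "y \<in> int_adjoin \<tau>" for y
      using that Re_base Im_base by (auto simp: ring)
    from this[OF Suc.IH] show ?case by (simp add: mult.assoc)
  qed (use that in simp)
  \<comment> \<open>The zero digit is not subject to the cell condition, so it has to be excluded.\<close>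
  have e_nonzero: "e \<noteq> 0"
  proof
    assume "e = 0"
    have "\<tau> ^ w = \<tau> * \<tau> ^ (w - 1)" using w_pos by (cases w) auto
    hence "- d = \<tau> * (\<tau> ^ (w - 1) * c)"
      using c(2) \<open>e = 0\<close> by (simp only: diff_0 mult.assoc)
    hence "d = \<tau> * (\<tau> ^ (w - 1) * (- c))"
      by (metis minus_minus mult_minus_right)
    moreover have "- c \<in> int_adjoin \<tau>" using c(1) by (simp add: ring)
    ultimately show False using d(2) base_in unfolding adjoin_dvd_def by blast
  qed
  hence "x + c \<in> restricted_voronoi_cell \<tau>"
    using digit_set e(1) e_eq unfolding minimal_norm_digit_set_def by fastforce
  moreover have "- c \<in> int_adjoin \<tau>" "0 \<in> int_adjoin \<tau>" using c(1) by (simp_all add: ring)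
  ultimately have "- c = 0"
    using restricted_voronoi_cell_tiling[OF ring int, of x] xV
    by (metis diff_0_right diff_minus_eq_add)
  hence "e = d" using c(2) by simp
  thus ?thesis using e(1) e_nonzero by simp
qed

text \<open>
  Multiplication by \<open>\<iota>\<close> rotates the half-open square by a right angle, which moves the present
  half of each side onto the present half of the next side; only midpoints and corners break this
  symmetry. So lattice points strictly inside such a half side remain digits after
  multiplication by any unit, and it does not matter which unit occurs in \<open>\<tau>\<^sup>w\<close>.
\<close>

lemma boundary_digit:
  assumes T: "\<tau> ^ w = 2 * of_int h * \<upsilon>" "\<upsilon> \<in> units" and u: "u \<in> units"
    and b: "0 < b" "b < h" "odd (h + b)"
  shows "u * (of_int h + of_int b * \<iota>) \<in> D - {0}"
proof -
  obtain \<upsilon>' where v: "\<upsilon>' \<in> units" "\<upsilon> * \<upsilon>' = 1" using units_inverse[OF T(2)] by blast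
  define s where "s = u * \<upsilon>'"
  define x where "x = s * (1 / 2 + of_real (of_int b / (2 * of_int h)) * \<iota>)"
  have s: "s \<in> units" using u v units_mult by (simp add: s_def)
  have us: "u = \<upsilon> * s" using v(2) by (simp add: s_def)
  have h: "h > 0" using b by simp
  show ?thesis
  proof (rule digitI)
    show "u * (of_int h + of_int b * \<iota>) \<in> int_adjoin \<tau>" by (rule in_ring[OF u])
    show "\<not> adjoin_dvd \<tau> \<tau> (u * (of_int h + of_int b * \<iota>))"
      by (rule not_dvd_of_odd_norm[OF norm_coords[OF u]]) (use b(3) in auto)
    show "u * (of_int h + of_int b * \<iota>) = \<tau> ^ w * x"
      unfolding T(1) us x_def using h by (simp add: field_simps)
    define y where "y = real_of_int b / (2 * real_of_int h)"
    have y: "0 < y" "y < 1 / 2" using b h by (simp_all add: y_def field_simps)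
    have x_eq: "x = s * (1 / 2 + of_real y * \<iota>)" by (simp add: x_def y_def)
    \<comment> \<open>The four quarter turns of a point on the present half of the right side.\<close>
    have "(Re x, Im \<tau> * Im x) \<in> {(1/2, y), (-1/2, -y), (- y, 1/2), (y, -1/2)}"
      using s Im_base unfolding x_eq by (auto simp: units_def \<iota>_def)
    moreover have "half_open_square (1/2) y" "half_open_square (-1/2) (- y)"
      "half_open_square (- y) (1/2)" "half_open_square y (-1/2)"
      unfolding half_open_square_def using y by simp_all
    ultimately show "half_open_square (Re x) (Im \<tau> * Im x)"
      unfolding insert_iff empty_iff prod.inject by metis
  qed
qed

text \<open>As soon as the half side is at least \<open>2\<close>, the units lie in the interior of the square.\<close>

lemma unit_digit:
  assumes T: "\<tau> ^ w = 2 * of_int h * \<upsilon>" "\<upsilon> \<in> units" and u: "u \<in> units" and h: "h \<ge> 2"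
  shows "u \<in> D - {0}"
proof -
  obtain \<upsilon>' where v: "\<upsilon>' \<in> units" "\<upsilon> * \<upsilon>' = 1" using units_inverse[OF T(2)] by blast
  define s where "s = u * \<upsilon>'"
  have s: "s \<in> units" using u v units_mult by (simp add: s_def)
  have us: "u = \<upsilon> * s" using v(2) by (simp add: s_def)
  define y where "y = 1 / (2 * real_of_int h)"
  have y: "0 < y" "y < 1 / 2" using h by (simp_all add: y_def field_simps)
  show ?thesis
  proof (rule digitI)
    show "u \<in> int_adjoin \<tau>" using in_ring[OF u, of 1 0] by simp
    show "\<not> adjoin_dvd \<tau> \<tau> u"
      by (rule not_dvd_of_odd_norm[of _ 1]) (use norm_coords[OF u, of 1 0] in simp_all)
    show "u = \<tau> ^ w * (s * of_real y)"
      unfolding T(1) us y_def using h by (simp add: field_simps)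
    have "\<bar>Re (s * of_real y)\<bar> < 1 / 2 \<and> \<bar>Im \<tau> * Im (s * of_real y)\<bar> < 1 / 2"
      using s Im_base y by (auto simp: units_def \<iota>_def)
    thus "half_open_square (Re (s * of_real y)) (Im \<tau> * Im (s * of_real y))"
      unfolding half_open_square_def by blast
  qed
qed

lemma even_power_base: "\<exists>\<upsilon>\<in>units. \<tau> ^ (2 * k) = 2 ^ k * \<upsilon>"
proof (induction k)
  case 0
  show ?case by (simp add: units_def)
next
  case (Suc k)
  then obtain \<upsilon> where v: "\<upsilon> \<in> units" "\<tau> ^ (2 * k) = 2 ^ k * \<upsilon>" by blast
  have "\<tau>\<^sup>2 = 2 * (of_real (Re \<tau>) * \<iota>)"
    using Re_base Im_base by (auto simp: \<iota>_def complex_eq_iff power2_eq_square)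
  hence "\<tau> ^ (2 * Suc k) = 2 ^ Suc k * (\<upsilon> * (of_real (Re \<tau>) * \<iota>))"
    using v(2) by (simp add: power2_eq_square)
  moreover have "of_real (Re \<tau>) * \<iota> \<in> units"
    using Re_base by (auto simp: units_def)
  hence "\<upsilon> * (of_real (Re \<tau>) * \<iota>) \<in> units"
    by (rule units_mult[OF v(1)])
  ultimately show ?case by blast
qed

section \<open>Non-optimal NAFs\<close>

text \<open>
  The non-zero digits are \<open>\<tau>\<^sup>2 \<iota> / 2\<close> and \<open>- \<tau>\<^sup>2 / 2\<close>, coming from the two midpoints that belong to
  the cell. Naming them so that \<open>\<tau>\<^sup>2 a = 2 b\<close> and \<open>\<tau>\<^sup>2 b = - 2 a\<close> (one of the two
  orders does this, as the first digit is \<open>- \<iota>\<close> times the second and \<open>\<tau>\<^sup>2 = 2 \<iota> Re \<tau>\<close>), one gets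
  \<open>- b = b - \<tau>\<^sup>2 a\<close> and \<open>- a = a + \<tau>\<^sup>2 b\<close>, hence
  \<open>- b = b + \<tau>\<^sup>2 a + \<tau> ^ 4 b\<close>. Since \<open>a + a = \<tau>\<^sup>2 (- b)\<close>, its NAF has weight \<open>3\<close>.
\<close>

lemma non_optimal_width_two:
  assumes w: "w = 2"
  shows "\<exists>z\<in>int_adjoin \<tau>. \<exists>\<eta>. w_naf_expansion \<tau> w D \<eta> z \<and> \<not> optimal_expansion \<tau> D \<eta> z"
proof -
  define a b where "a = (if Re \<tau> = 1 then - 1 else \<iota>)" and "b = (if Re \<tau> = 1 then - \<iota> else 1)"
  have sq: "\<tau> ^ 2 = 2 * (of_real (Re \<tau>) * \<iota>)"
    using Re_base Im_base by (auto simp: \<iota>_def complex_eq_iff power2_eq_square)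
  have units: "a \<in> units" "b \<in> units" by (auto simp: a_def b_def units_def)
  have digit: "d \<in> D - {0}"
    if "d \<in> units" "d = \<tau> ^ w * x" "x = \<iota> / 2 \<or> x = - 1 / 2" for d x
  proof (rule digitI[OF _ _ that(2)])
    show "d \<in> int_adjoin \<tau>" using in_ring[OF that(1), of 1 0] by simp
    show "\<not> adjoin_dvd \<tau> \<tau> d"
      by (rule not_dvd_of_odd_norm[of _ 1]) (use norm_coords[OF that(1), of 1 0] in simp_all)
    have "Re x = 0 \<and> Im \<tau> * Im x = 1 / 2 \<or> Re x = - 1 / 2 \<and> Im \<tau> * Im x = 0"
      using that(3) Im_base unfolding \<iota>_def complex_eq_iff by auto
    moreover have "half_open_square 0 (1 / 2)" "half_open_square (- 1 / 2) 0"
      by (simp_all add: half_open_square_def)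
    ultimately show "half_open_square (Re x) (Im \<tau> * Im x)" by metis
  qed
  have "a \<in> D - {0}"
    by (rule digit[of _ "if Re \<tau> = 1 then \<iota> / 2 else - 1 / 2"])
      (use units Re_base in \<open>auto simp: a_def w sq iota_square\<close>)
  moreover have "b \<in> D - {0}"
    by (rule digit[of _ "if Re \<tau> = 1 then - 1 / 2 else \<iota> / 2"])
      (use units Re_base in \<open>auto simp: b_def w sq iota_square\<close>)
  moreover have "a + \<tau> ^ 0 * a = \<tau> ^ 2 * (b + \<tau> ^ w * a + \<tau> ^ (2 * w) * b)"
  proof -
    have "2 * a = - (\<tau> ^ 2 * b)" "2 * b = \<tau> ^ 2 * a"
      using Re_base by (auto simp: a_def b_def sq iota_square)
    hence carry: "\<tau> ^ 2 * b = - (2 * a)" "\<tau> ^ 2 * a = 2 * b"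
      by (simp_all only: minus_minus)
    have "\<tau> ^ (2 * w) * b = \<tau> ^ 2 * (\<tau> ^ 2 * b)"
      unfolding w mult.assoc[symmetric] power_add[symmetric] by simp
    also have "\<dots> = - (2 * (\<tau> ^ 2 * a))"
      by (simp add: carry(1))
    finally have "\<tau> ^ (2 * w) * b = - (4 * b)"
      by (simp add: carry(2))
    hence "b + \<tau> ^ w * a + \<tau> ^ (2 * w) * b = - b"
      by (simp add: w carry(2))
    thus ?thesis
      using carry(1) by (simp only: power_0 mult_1_left mult_minus_right minus_minus mult_2)
  qed
  moreover have "a + \<tau> ^ 0 * a \<in> int_adjoin \<tau>"
    using in_ring[OF units(1), of 2 0] by (simp add: mult.commute)
  moreover have "0 \<in> D" using digit_set by (simp add: minimal_norm_digit_set_def)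
  ultimately show ?thesis
    by (intro non_optimal_weight_three[where a = a and b = a and l = 0 and k = 2
          and d\<^sub>0 = b and d\<^sub>1 = a and d\<^sub>2 = b and z = "a + \<tau> ^ 0 * a"]) (use w_pos in auto)
qed

text \<open>
  The key identity carries twice. Replacing the digit \<open>\<kappa>\<close> by \<open>\<kappa> \<iota> A\<close> adds \<open>1\<close> to the digit
  \<open>A\<close> in position \<open>w - 1\<close>. The sum \<open>A + 1\<close> is divisible by \<open>\<tau>\<close> but the quotient lies on a
  missing half side, which forces a carry to position \<open>2 w\<close>.
\<close>

lemma non_optimal_width_ge_four:
  assumes w: "even w" "w \<ge> 4"
  shows "\<exists>z\<in>int_adjoin \<tau>. \<exists>\<eta>. w_naf_expansion \<tau> w D \<eta> z \<and> \<not> optimal_expansion \<tau> D \<eta> z"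
proof -
  obtain k where k: "w = 2 * (k + 2)"
  proof
    show "w = 2 * (w div 2 - 2 + 2)" using w by presburger
  qed
  define h :: int where "h = 2 ^ (k + 1)"
  have h: "h \<ge> 2" "even h" by (simp_all add: h_def)
  obtain \<upsilon> where v: "\<upsilon> \<in> units" "\<tau> ^ w = 2 * of_int h * \<upsilon>"
    using even_power_base[of "k + 2"] by (auto simp: k h_def)
  obtain \<kappa>' where k': "\<kappa>' \<in> units" "\<tau> ^ (2 * (k + 1)) = of_int h * \<kappa>'"
    using even_power_base[of "k + 1"] by (auto simp: h_def)
  \<comment> \<open>\<open>\<tau>\<close> is a unit times \<open>1 - \<iota>\<close>; \<open>\<kappa>\<close> collects the units of \<open>\<tau> ^ (w - 1)\<close>.\<close>
  define \<kappa> where "\<kappa> = \<kappa>' * (if Re \<tau> = 1 then \<iota> else - 1)"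
  have base: "\<tau> = (if Re \<tau> = 1 then \<iota> else - 1) * (1 - \<iota>)"
    using Re_base by (subst base_eq) (auto simp: iota_square algebra_simps)
  have \<kappa>: "\<kappa> \<in> units"
    unfolding \<kappa>_def by (rule units_mult[OF k'(1)]) (simp add: units_def)
  have "\<tau> ^ (w - 1) = \<tau> ^ (2 * (k + 1)) * \<tau>"
    by (simp add: k)
  hence T1: "\<tau> ^ (w - 1) = of_int h * \<kappa> * (1 - \<iota>)"
    unfolding k'(2) by (subst (asm) (2) base) (simp add: \<kappa>_def)
  obtain \<upsilon>' where v': "\<upsilon>' \<in> units" "\<upsilon> * \<upsilon>' = 1" using units_inverse[OF v(1)] by blast
  define A B where "A = of_int h + of_int (h - 1) * \<iota>" and "B = of_int h + of_int 1 * \<iota>"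
  have A: "u * A \<in> D - {0}" if "u \<in> units" for u
    unfolding A_def by (rule boundary_digit[OF v(2,1) that]) (use h in auto)
  have B: "u * B \<in> D - {0}" if "u \<in> units" for u
    unfolding B_def by (rule boundary_digit[OF v(2,1) that]) (use h in auto)
  have U: "u \<in> D - {0}" if "u \<in> units" for u
    by (rule unit_digit[OF v(2,1) that h(1)])
  have key: "\<kappa> + \<tau> ^ (w - 1) * A =
      \<kappa> * \<iota> * A + \<tau> ^ w * (- (\<kappa> * \<upsilon>') * B) + \<tau> ^ (2 * w) * (\<kappa> * \<upsilon>' * \<upsilon>')"
  proof -
    have first: "\<tau> ^ w * (- (\<kappa> * \<upsilon>') * B) = - (2 * of_int h * \<kappa> * B) * (\<upsilon> * \<upsilon>')"
      unfolding v(2) by (simp only: mult_ac mult_minus_left mult_minus_right)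
    have second: "\<tau> ^ (2 * w) * (\<kappa> * \<upsilon>' * \<upsilon>') = 4 * (of_int h)\<^sup>2 * \<kappa> * (\<upsilon> * \<upsilon>')\<^sup>2"
      unfolding power_even_eq v(2) by (simp add: power2_eq_square)
    show ?thesis
      unfolding first second unfolding T1 A_def B_def v'(2)
      by (simp add: algebra_simps iota_square power2_eq_square)
  qed
  have z: "\<kappa> + \<tau> ^ (w - 1) * A = \<kappa> * (of_int (2 * h\<^sup>2 - h + 1) + of_int (- h) * \<iota>)"
    unfolding T1 A_def by (simp add: algebra_simps iota_square power2_eq_square)
  show ?thesis
  proof (rule non_optimal_weight_three[where k = 0 and l = "w - 1"])
    show "\<kappa> + \<tau> ^ (w - 1) * A \<in> int_adjoin \<tau>" unfolding z by (rule in_ring[OF \<kappa>])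
    show "\<kappa> + \<tau> ^ (w - 1) * A = \<tau> ^ 0 * (\<kappa> * \<iota> * A + \<tau> ^ w * (- (\<kappa> * \<upsilon>') * B)
        + \<tau> ^ (2 * w) * (\<kappa> * \<upsilon>' * \<upsilon>'))" using key by simp
    have "1 * A \<in> D - {0}" by (rule A) (simp add: units_def)
    moreover have "\<kappa> * \<iota> * A \<in> D - {0}" by (intro A units_mult \<kappa> iota_unit)
    moreover have "- (\<kappa> * \<upsilon>') * B \<in> D - {0}" by (intro B units_uminus units_mult \<kappa> v'(1))
    moreover have "\<kappa> * \<upsilon>' * \<upsilon>' \<in> D - {0}" by (intro U units_mult \<kappa> v'(1))
    moreover have "\<kappa> \<in> D - {0}" by (rule U[OF \<kappa>])
    ultimately show "{\<kappa> * \<iota> * A, - (\<kappa> * \<upsilon>') * B, \<kappa> * \<upsilon>' * \<upsilon>', \<kappa>, A} \<subseteq> D - {0}"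
      by simp
  qed (use w_pos digit_set in \<open>simp_all add: minimal_norm_digit_set_def\<close>)
qed

end

theorem proposition9p3:
  fixes p q :: int and \<tau> :: complex and w :: nat and D :: "complex set"
  assumes "p \<in> {-2, 2}" and "q = 2"
    and "\<tau>\<^sup>2 - of_int p * \<tau> + of_int q = 0"
    and "even w" and "w \<ge> 2"
    and "minimal_norm_digit_set \<tau> w D"
  shows "\<exists>z\<in>int_adjoin \<tau>. \<exists>\<eta>. w_naf_expansion \<tau> w D \<eta> z \<and> \<not> optimal_expansion \<tau> D \<eta> z"
proof -
  have root: "\<tau>\<^sup>2 - of_int p * \<tau> + 2 = 0" using assms(2,3) by simp
  interpret gaussian_digits \<tau> w D
  proof
    show "int_adjoin \<tau> = {z. Re z \<in> \<int> \<and> Im z \<in> \<int>}"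
      by (rule int_adjoin_eq_Gauss[OF assms(1) root])
    show "Re \<tau> = 1 \<or> Re \<tau> = - 1" "Im \<tau> = 1 \<or> Im \<tau> = - 1"
      using quadratic_roots[OF assms(1) root] assms(1) by auto
  qed (use assms in auto)
  from \<open>even w\<close> \<open>w \<ge> 2\<close> have "w = 2 \<or> w \<ge> 4" by presburger
  with non_optimal_width_two non_optimal_width_ge_four assms(4) show ?thesis by blast
qed

end
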